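(* Let $n$ be a positive integer with exactly $k>1$ distinct prime factors, let $q_1$ be its smallest prime factor, and suppose $\sigma^{-1}(n)<1+\frac{1}{2q_1}$. Then $$L(n)<\frac{q_1}{q_1-1}\,\bigl(2k-1-\sigma^{-1}(n)\bigr)\,2q_1,\qquad\text{so}\qquad g(n)<4kq_1\,\frac{q_1}{q_1-1}.$$
   Context: For an integer $n>1$, let $k=\omega(n)$ be the number of distinct primes dividing $n$, and let $q_1<q_2<\dots<q_k$ be these primes. Define $\sigma^{-1}(n)=\sum_{i=1}^k 1/q_i$ (the superscript $-1$ is part of the name, not an exponent or inverse). Jacobsthal's function $g(n)$ is the smallest positive integer $m$ such that for every integer $a$ the set $\{a+1,\dots,a+m\}$ contains an integer coprime to $n$. $L(n)$ is the largest integer $l$ such that there is a set of $l$ consecutive integers $\{b+1,\dots,b+l\}$ with $\gcd(b+j,n)>1$ for every $1\le j\le l$. *)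

theory Defs
  imports Complex_Main "HOL-Computational_Algebra.Primes"
begin

text \<open>The superscript in \<open>\<sigma>\<^sup>-\<^sup>1(n)\<close> is part of the name of the
  function: it is the sum of the reciprocals of the distinct primes dividing \<open>n\<close>.\<close>

definition sigma_inv :: "nat \<Rightarrow> real" where
  "sigma_inv n = (\<Sum>q\<in>prime_factors n. 1 / real q)"

definition jacobsthal :: "nat \<Rightarrow> nat" where
  "jacobsthal n =
     (LEAST m. 0 < m \<and> (\<forall>a::int. \<exists>x\<in>{a + 1..a + int m}. coprime x (int n)))"

definition noncoprime_run :: "nat \<Rightarrow> nat \<Rightarrow> bool" where
  "noncoprime_run n l \<longleftrightarrow> (\<exists>b::int. \<forall>j\<in>{1..l}. gcd (b + int j) (int n) > 1)"

definition longest_run :: "nat \<Rightarrow> nat" where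
  "longest_run n = (GREATEST l. noncoprime_run n l)"

text \<open>The least and the greatest element in these definitions exist for \<open>n > 0\<close>: any \<open>n\<close>
  consecutive integers contain one that is congruent to 1 modulo \<open>n\<close>.\<close>

lemma coprime_in_block:
  fixes a :: int
  assumes "n > 0"
  shows "\<exists>x\<in>{a + 1..a + int n}. coprime x (int n)"
proof -
  define x where "x = a + 1 + (- a) mod int n"
  have "0 \<le> (- a) mod int n" "(- a) mod int n < int n"
    using assms by simp_all
  then have "x \<in> {a + 1..a + int n}"
    by (simp add: x_def)
  moreover have "x mod int n = 1 mod int n"
    unfolding x_def by (simp add: mod_simps)
  then have "gcd x (int n) = 1"
    by (metis gcd_1_int gcd.commute gcd_red_int)
  then have "coprime x (int n)"
    by (simp add: coprime_iff_gcd_eq_1)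
  ultimately show ?thesis by blast
qed

lemma jacobsthal_works:
  assumes "n > 0"
  shows "0 < jacobsthal n \<and>
    (\<forall>a::int. \<exists>x\<in>{a + 1..a + int (jacobsthal n)}. coprime x (int n))"
  unfolding jacobsthal_def
  by (rule LeastI[where k = n]) (use assms coprime_in_block in blast)

lemma noncoprime_run_less:
  assumes "n > 0" "noncoprime_run n l"
  shows "l < n"
proof (rule ccontr)
  assume "\<not> l < n"
  obtain b :: int where b: "\<forall>j\<in>{1..l}. gcd (b + int j) (int n) > 1"
    using assms(2) by (auto simp: noncoprime_run_def)
  obtain x where x: "x \<in> {b + 1..b + int n}" "coprime x (int n)"
    using coprime_in_block[OF assms(1)] by blast
  have "nat (x - b) \<in> {1..l}" "b + int (nat (x - b)) = x"
    using x(1) \<open>\<not> l < n\<close> by auto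
  with b have "gcd x (int n) > 1" by metis
  with x(2) show False by simp
qed

lemma longest_run_works:
  assumes "n > 0"
  shows "noncoprime_run n (longest_run n)"
    and "noncoprime_run n l \<Longrightarrow> l \<le> longest_run n"
proof -
  have 0: "noncoprime_run n 0" by (simp add: noncoprime_run_def)
  have bd: "\<And>l. noncoprime_run n l \<Longrightarrow> l \<le> n"
    using noncoprime_run_less[OF assms] by (simp add: less_imp_le)
  show "noncoprime_run n (longest_run n)"
    unfolding longest_run_def using 0 bd by (rule GreatestI_nat)
  show "l \<le> longest_run n" if "noncoprime_run n l"
    unfolding longest_run_def using that bd by (rule Greatest_le_nat)
qed

end

theory Submission
  imports Defs
begin

text \<open>
  Suppose that each of \<open>l\<close> consecutive integers shares a prime with \<open>n\<close>, and write \<open>q\<close> for \<open>q1\<close>.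
  Covering them by the multiples of all the primes only helps when \<open>\<sigma>\<^sup>-\<^sup>1(n) < 1\<close>. One gains an
  extra \<open>1/q\<close> by sieving by \<open>q\<close> first: the integers of the block prime to \<open>q\<close>, of which there are
  at least \<open>(1 - 1/q)(l - 1)\<close>, must be covered by the remaining primes, and each such prime \<open>p\<close>
  is only charged for its multiples that are prime to \<open>q\<close>, roughly a proportion \<open>1 - 1/q\<close> of them and
  at most \<open>(1 - 1/q)(l/p + 2 - 1/p)\<close> (lemma \<open>card_multiples_not_dvd_le\<close>). After cancelling
  \<open>1 - 1/q\<close> this leaves
  \<open>l (1 + 1/q - \<sigma>\<^sup>-\<^sup>1(n)) \<le> 2k - 1 - \<sigma>\<^sup>-\<^sup>1(n) + 1/q\<close> (lemma \<open>noncoprime_run_sieve_bound\<close>).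
  The hypothesis says exactly that the factor of \<open>l\<close> exceeds \<open>1/(2q)\<close>, which gives the bound
  for \<open>L(n)\<close> because the stray \<open>1/q\<close> costs less than the factor \<open>q/(q - 1)\<close> allows; the one
  for \<open>g(n)\<close> follows from \<open>g(n) \<le> L(n) + 1\<close>.
\<close>

section \<open>Multiples in a block of consecutive integers\<close>

lemma multiples_eq_image:
  fixes b c d :: int
  assumes "d > 0"
  shows "{x \<in> {b + 1..c}. d dvd x} = (\<lambda>y. d * y) ` {b div d + 1..c div d}"
proof -
  have iff: "b + 1 \<le> d * y \<longleftrightarrow> b div d + 1 \<le> y" "d * y \<le> c \<longleftrightarrow> y \<le> c div d" for y
  proof -
    have le: "d * y \<le> a \<longleftrightarrow> y \<le> a div d" for a
    proof
      assume "d * y \<le> a"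
      then have "(d * y) div d \<le> a div d" using assms by (rule zdiv_mono1)
      then show "y \<le> a div d" using assms by simp
    next
      assume "y \<le> a div d"
      then have "d * y \<le> d * (a div d)" using assms by simp
      also have "\<dots> \<le> a" using assms by (simp add: minus_mod_eq_mult_div[symmetric])
      finally show "d * y \<le> a" .
    qed
    show "d * y \<le> c \<longleftrightarrow> y \<le> c div d" by (rule le)
    show "b + 1 \<le> d * y \<longleftrightarrow> b div d + 1 \<le> y" using le[of b] by linarith
  qed
  show ?thesis
    by (auto simp: iff dvd_def)
qed

lemma card_multiples:
  fixes b c d :: int
  assumes "d > 0"
  shows "card {x \<in> {b + 1..c}. d dvd x} = nat (c div d - b div d)"
  unfolding multiples_eq_image[OF assms] using assms by (simp add: card_image inj_on_def)

lemma card_multiples_bounds: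
  fixes b :: int and d l :: nat
  assumes "d > 0"
  shows "real (card {x \<in> {b + 1..b + int l}. int d dvd x}) \<le> real l / real d + 1 - 1 / real d"
    and "real l / real d - 1 + 1 / real d \<le> real (card {x \<in> {b + 1..b + int l}. int d dvd x})"
proof -
  define M where "M = card {x \<in> {b + 1..b + int l}. int d dvd x}"
  have d: "int d > 0" using assms by simp
  have "b div int d \<le> (b + int l) div int d"
    using d by (simp add: zdiv_mono1)
  then have "int M = (b + int l) div int d - b div int d"
    unfolding M_def card_multiples[OF d] by simp
  then have "int d * int M = (b + int l - (b + int l) mod int d) - (b - b mod int d)"
    by (simp add: right_diff_distrib minus_mod_eq_mult_div)
  moreover have "0 \<le> b mod int d" "b mod int d < int d"
      "0 \<le> (b + int l) mod int d" "(b + int l) mod int d < int d"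
    using d by simp_all
  ultimately have "int d * int M \<le> int l + int d - 1" "int l - int d + 1 \<le> int d * int M"
    by linarith+
  then have "real_of_int (int d * int M) \<le> real_of_int (int l + int d - 1)"
      "real_of_int (int l - int d + 1) \<le> real_of_int (int d * int M)"
    by (simp_all only: of_int_le_iff)
  then have "real M \<le> (real l + real d - 1) / real d" "(real l - real d + 1) / real d \<le> real M"
    using assms by (simp_all add: pos_le_divide_eq pos_divide_le_eq mult.commute)
  then show "real (card {x \<in> {b + 1..b + int l}. int d dvd x}) \<le> real l / real d + 1 - 1 / real d"
    and "real l / real d - 1 + 1 / real d \<le> real (card {x \<in> {b + 1..b + int l}. int d dvd x})"
    using assms by (simp_all add: M_def add_divide_distrib diff_divide_distrib)
qed

text \<open>The multiples of \<open>p\<close> in the block are \<open>p * y\<close> with \<open>y\<close> running through consecutive integers,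
  and \<open>q\<close> divides \<open>p * y\<close> iff it divides \<open>y\<close>; so the count of multiples applies twice.
  Each application costs at most one unit of error, whence the \<open>2\<close>.\<close>

lemma card_multiples_not_dvd_le:
  fixes b :: int and l p q :: nat
  assumes "p > 0" "q > 0" "coprime p q"
  shows "real (card {x \<in> {b + 1..b + int l}. int p dvd x \<and> \<not> int q dvd x})
           \<le> (1 - 1 / real q) * (real l / real p + 2 - 1 / real p)"
proof -
  define I where "I = {b + 1..b + int l}"
  define u where "u = b div int p"
  define M where "M = card {x \<in> I. int p dvd x}"
  define N where "N = card {y \<in> {u + 1..u + int M}. int q dvd y}"
  have p: "int p > 0" and q: "int q > 0" using assms by simp_all
  have "u \<le> (b + int l) div int p"
    using p by (simp add: u_def zdiv_mono1)
  then have top: "(b + int l) div int p = u + int M"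
    unfolding M_def I_def card_multiples[OF p] u_def by simp
  have cop: "int q dvd int p * y \<longleftrightarrow> int q dvd y" for y
    using assms(3) by (simp add: coprime_dvd_mult_right_iff coprime_commute)
  have img: "{x \<in> I. int p dvd x} = (\<lambda>y. int p * y) ` {u + 1..u + int M}"
    unfolding I_def by (simp only: multiples_eq_image[OF p] top u_def)
  have "{x \<in> I. int p dvd x \<and> int q dvd x} = {x \<in> {x \<in> I. int p dvd x}. int q dvd x}"
    by blast
  also have "\<dots> = (\<lambda>y. int p * y) ` {y \<in> {u + 1..u + int M}. int q dvd y}"
    unfolding img by (auto simp: cop)
  finally have N: "card {x \<in> I. int p dvd x \<and> int q dvd x} = N"
    using p by (simp add: N_def card_image inj_on_def)
  have "{x \<in> I. int p dvd x \<and> \<not> int q dvd x}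
      = {x \<in> I. int p dvd x} - {x \<in> I. int p dvd x \<and> int q dvd x}"
    by blast
  moreover have "finite I" by (simp add: I_def)
  then have "finite {x \<in> I. int p dvd x}" "finite {x \<in> I. int p dvd x \<and> int q dvd x}"
    by simp_all
  moreover have "{x \<in> I. int p dvd x \<and> int q dvd x} \<subseteq> {x \<in> I. int p dvd x}"
    by blast
  ultimately have "card {x \<in> I. int p dvd x \<and> \<not> int q dvd x} = M - N" "N \<le> M"
    using N card_mono[of "{x \<in> I. int p dvd x}" "{x \<in> I. int p dvd x \<and> int q dvd x}"]
    by (simp_all add: card_Diff_subset M_def)
  then have card: "real (card {x \<in> I. int p dvd x \<and> \<not> int q dvd x}) = real M - real N"
    by (simp add: of_nat_diff)
  have M_le: "real M \<le> real l / real p + 1 - 1 / real p"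
    unfolding M_def I_def by (rule card_multiples_bounds(1)[OF assms(1)])
  have N_ge: "real M / real q - 1 + 1 / real q \<le> real N"
    unfolding N_def by (rule card_multiples_bounds(2)[OF assms(2)])
  have "real M - real N \<le> (1 - 1 / real q) * (real M + 1)"
    using N_ge by (simp add: algebra_simps add_divide_distrib)
  also have "\<dots> \<le> (1 - 1 / real q) * (real l / real p + 2 - 1 / real p)"
    using M_le q by (intro mult_left_mono) simp_all
  finally show ?thesis
    using card by (simp add: I_def)
qed

section \<open>Runs of integers sharing a prime with n\<close>

lemma noncoprime_run_sieve_bound:
  fixes n q l :: nat
  assumes run: "noncoprime_run n l" and q: "q \<in> prime_factors n"
  shows "real l * (1 + 1 / real q - sigma_inv n)
           \<le> 2 * real (card (prime_factors n)) - 1 - sigma_inv n + 1 / real q"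
proof -
  obtain b :: int where b: "\<And>j. j \<in> {1..l} \<Longrightarrow> gcd (b + int j) (int n) > 1"
    using run unfolding noncoprime_run_def by blast
  define I where "I = {b + 1..b + int l}"
  define P where "P = prime_factors n - {q}"
  define B where "B p = {x \<in> I. int p dvd x \<and> \<not> int q dvd x}" for p
  have finP: "finite P" by (simp add: P_def)
  have n: "n > 0" and pq: "prime q" using q by (auto simp: prime_factors_dvd intro: Nat.gr0I)
  have q1: "real q > 1" using prime_gt_1_nat[OF pq] by simp
  have finI: "finite I" by (simp add: I_def)
  have cover: "I - {x \<in> I. int q dvd x} \<subseteq> (\<Union>p\<in>P. B p)"
  proof
    fix x assume x: "x \<in> I - {x \<in> I. int q dvd x}"
    have "nat (x - b) \<in> {1..l}" "b + int (nat (x - b)) = x"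
      using x by (auto simp: I_def)
    then have "gcd x (int n) > 1" using b by metis
    then have "\<not> is_unit (gcd x (int n))" by simp
    then obtain r where r: "prime r" "r dvd gcd x (int n)"
      using prime_divisor_exists[of "gcd x (int n)"] n by auto
    define p where "p = nat r"
    have p: "r = int p" "prime p" using r(1) by (auto simp: p_def prime_ge_0_int)
    have "int p dvd x" "p dvd n" using r(2) p(1) by auto
    then have "p \<in> P" "x \<in> B p"
      using x p(2) n by (auto simp: P_def B_def prime_factors_dvd)
    then show "x \<in> (\<Union>p\<in>P. B p)" by blast
  qed
  have A_le: "real (card {x \<in> I. int q dvd x}) \<le> real l / real q + 1 - 1 / real q"
    unfolding I_def using prime_gt_0_nat[OF pq] by (rule card_multiples_bounds(1))
  have "real l - real (card {x \<in> I. int q dvd x}) = real (card (I - {x \<in> I. int q dvd x}))"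
  proof -
    have "{x \<in> I. int q dvd x} \<subseteq> I" by blast
    moreover have "card I = l" by (simp add: I_def)
    ultimately have "card (I - {x \<in> I. int q dvd x}) = l - card {x \<in> I. int q dvd x}"
        "card {x \<in> I. int q dvd x} \<le> l"
      using finI card_mono[of I "{x \<in> I. int q dvd x}"]
      by (simp_all add: card_Diff_subset)
    then show ?thesis by (simp add: of_nat_diff)
  qed
  also have "\<dots> \<le> real (card (\<Union>p\<in>P. B p))"
    using cover finI finP by (intro of_nat_mono card_mono) (auto simp: B_def)
  also have "\<dots> \<le> (\<Sum>p\<in>P. real (card (B p)))"
    using card_UN_le[OF finP, of B] by (metis of_nat_mono of_nat_sum)
  also have "\<dots> \<le> (\<Sum>p\<in>P. (1 - 1 / real q) * (real l / real p + 2 - 1 / real p))"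
  proof (rule sum_mono)
    fix p assume "p \<in> P"
    then have "prime p" "p \<noteq> q" by (auto simp: P_def prime_factors_dvd)
    then show "real (card (B p)) \<le> (1 - 1 / real q) * (real l / real p + 2 - 1 / real p)"
      unfolding B_def I_def using pq
      by (intro card_multiples_not_dvd_le) (auto simp: primes_coprime prime_gt_0_nat)
  qed
  also have "\<dots> = (1 - 1 / real q) * ((real l - 1) * (\<Sum>p\<in>P. 1 / real p) + 2 * real (card P))"
  proof -
    have "(\<Sum>p\<in>P. real l / real p + 2 - 1 / real p) = (\<Sum>p\<in>P. (real l - 1) * (1 / real p) + 2)"
      by (intro sum.cong) (simp_all add: algebra_simps diff_divide_distrib)
    also have "\<dots> = (real l - 1) * (\<Sum>p\<in>P. 1 / real p) + 2 * real (card P)"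
      by (simp only: sum.distrib sum_distrib_left[symmetric] sum_constant)
    finally show ?thesis by (simp only: sum_distrib_left[symmetric])
  qed
  finally have main: "real l - real (card {x \<in> I. int q dvd x})
      \<le> (1 - 1 / real q) * ((real l - 1) * (\<Sum>p\<in>P. 1 / real p) + 2 * real (card P))" .
  have "(1 - 1 / real q) * (real l - 1) \<le> real l - real (card {x \<in> I. int q dvd x})"
    using A_le by (simp add: algebra_simps diff_divide_distrib)
  with main have "(1 - 1 / real q) * (real l - 1)
      \<le> (1 - 1 / real q) * ((real l - 1) * (\<Sum>p\<in>P. 1 / real p) + 2 * real (card P))"
    by linarith
  then have "real l - 1 \<le> (real l - 1) * (\<Sum>p\<in>P. 1 / real p) + 2 * real (card P)"
    using q1 by (simp add: mult_le_cancel_left_pos)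
  moreover have "(\<Sum>p\<in>P. 1 / real p) = sigma_inv n - 1 / real q"
    using q by (simp add: P_def sigma_inv_def sum_diff1)
  moreover have "real (card P) = real (card (prime_factors n)) - 1"
  proof -
    have "card (prime_factors n) = Suc (card P)"
      using q unfolding P_def by (intro card.remove) simp_all
    then show ?thesis by simp
  qed
  ultimately show ?thesis by (simp add: algebra_simps diff_divide_distrib)
qed

text \<open>A block of length \<open>L(n) + 1\<close> free of integers coprime to \<open>n\<close> would be a longer run.\<close>

lemma jacobsthal_le_longest_run:
  assumes "n > 0"
  shows "jacobsthal n \<le> longest_run n + 1"
proof -
  have "\<exists>x\<in>{a + 1..a + int (longest_run n + 1)}. coprime x (int n)" for a :: int
  proof (rule ccontr)
    assume none: "\<not> ?thesis"
    have "noncoprime_run n (longest_run n + 1)"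
      unfolding noncoprime_run_def
    proof (intro exI ballI)
      fix j assume "j \<in> {1..longest_run n + 1}"
      then have "\<not> coprime (a + int j) (int n)" using none by auto
      moreover have "gcd (a + int j) (int n) > 0" using assms by simp
      ultimately show "gcd (a + int j) (int n) > 1"
        unfolding coprime_iff_gcd_eq_1 by linarith
    qed
    from longest_run_works(2)[OF assms this] show False by simp
  qed
  then show ?thesis
    unfolding jacobsthal_def by (intro Least_le) simp
qed

section \<open>The bounds\<close>

theorem mainTheorem5:
  fixes n k q1 :: nat
  assumes "n > 0"
    and "k = card (prime_factors n)"
    and "k > 1"
    and "q1 = Min (prime_factors n)"
    and "sigma_inv n < 1 + 1 / (2 * real q1)"
  shows "real (longest_run n)
           < real q1 / (real q1 - 1) * (2 * real k - 1 - sigma_inv n) * (2 * real q1)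
       \<and> real (jacobsthal n) < 4 * real k * real q1 * (real q1 / (real q1 - 1))"
proof -
  define L where "L = real (longest_run n)"
  define s where "s = sigma_inv n"
  define Q where "Q = real q1"
  define E where "E = 2 * real k - 1 - s"
  have "prime_factors n \<noteq> {}" using assms by auto
  then have q1: "q1 \<in> prime_factors n" using assms(4) by (simp add: Min_in)
  then have Q: "Q \<ge> 2"
    using prime_ge_2_nat[of q1] by (auto simp: Q_def prime_factors_dvd)
  have s0: "s \<ge> 0" by (auto simp: s_def sigma_inv_def intro: sum_nonneg)
  have s: "s < 1 + 1 / (2 * Q)" using assms(5) by (simp add: s_def Q_def)
  have "1 / (2 * Q) \<le> 1 / 4" using Q by (simp add: field_simps)
  then have E1: "E > 1" using s assms(3) by (simp add: E_def)
  have sieve: "L * (1 + 1 / Q - s) \<le> E + 1 / Q"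
    using noncoprime_run_sieve_bound[OF longest_run_works(1)[OF assms(1)] q1] assms(2)
    by (simp add: L_def s_def Q_def E_def)
  have "1 / (2 * Q) \<le> 1 + 1 / Q - s"
    using s Q by (simp add: field_simps)
  then have "L * (1 / (2 * Q)) \<le> E + 1 / Q"
    using sieve mult_left_mono[of "1 / (2 * Q)" "1 + 1 / Q - s" L] by (simp add: L_def)
  then have "L \<le> (E + 1 / Q) * (2 * Q)"
    using Q by (simp add: pos_divide_le_eq)
  \<comment> \<open>The term \<open>1 / Q\<close> is absorbed by the factor \<open>Q / (Q - 1)\<close>, because
    \<open>Q / (Q - 1) * E = E + E / (Q - 1)\<close> and \<open>E > 1\<close>.\<close>
  also have "\<dots> < Q / (Q - 1) * E * (2 * Q)"
  proof (rule mult_strict_right_mono)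
    have "(E + 1 / Q) * (Q - 1) = Q * E + (1 - E) - 1 / Q"
      using Q by (simp add: field_simps)
    moreover have "1 / Q > 0" using Q by simp
    ultimately have "(E + 1 / Q) * (Q - 1) < Q * E"
      using E1 by linarith
    then show "E + 1 / Q < Q / (Q - 1) * E"
      using Q by (simp add: pos_less_divide_eq)
  qed (use Q in simp)
  finally have L: "L < Q / (Q - 1) * E * (2 * Q)" .
  have "1 \<le> Q / (Q - 1)" using Q by (simp add: field_simps)
  then have "1 * (1 * 1) \<le> Q / (Q - 1) * ((1 + s) * (2 * Q))"
    using Q s0 by (intro mult_mono) simp_all
  then have "L + 1 < Q / (Q - 1) * E * (2 * Q) + Q / (Q - 1) * ((1 + s) * (2 * Q))"
    using L by linarith
  also have "\<dots> = Q / (Q - 1) * ((E + (1 + s)) * (2 * Q))"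
    by (simp only: distrib_left distrib_right mult.assoc)
  also have "\<dots> = 4 * real k * Q * (Q / (Q - 1))"
    by (simp add: E_def)
  finally have "L + 1 < 4 * real k * Q * (Q / (Q - 1))" .
  moreover have "real (jacobsthal n) \<le> L + 1"
    using jacobsthal_le_longest_run[OF assms(1)] by (simp add: L_def)
  ultimately have "real (jacobsthal n) < 4 * real k * Q * (Q / (Q - 1))"
    by linarith
  with L show ?thesis by (simp add: L_def Q_def E_def s_def)
qed

end
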